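(* Let $B^*\subset\mathbb{R}^k$ be a bounded domain, let $M>1$, and let $R>0$ be small enough. If $\{\Omega_m\}_{m=1}^\infty\subset\mathscr{C}_{M,R}$, then there exist a subsequence $\{\Omega_{m_j}\}_{j=1}^\infty$ and a set $\Omega\in\mathscr{C}_{M,R}$ such that $\rho(\Omega_{m_j},\Omega)\to 0$ as $j\to\infty$. That is, $(\mathscr{C}_{M,R},\rho)$ is a compact metric space.
   Context: $B(z,r)$ denotes the open Euclidean ball in $\mathbb{R}^k$ with center $z$ and radius $r$; $\mathrm{dist}$ is Euclidean distance. Property $(C_M)$: for a constant $M>1$, an open set $\Omega\subset\mathbb{R}^k$ has property $(C_M)$ if for any $x,y\in\Omega$ there exists a connected compact set $K$ with $x,y\in K$, $K\subset\Omega$ and $\bigcup_{z\in K}B(z,\frac{d^*}{M})\subset\Omega$, where $d^*=\min\{\mathrm{dist}(x,\partial\Omega),\mathrm{dist}(y,\partial\Omega)\}$. The class: $\mathscr{C}_{M,R}$ is the set of all open sets $\Omega\subset\mathbb{R}^k$ satisfying property $(C_M)$ such that $B(x_\Omega,R)\subset\Omega\subset B^*$ for some point $x_\Omega\in\Omega$ (depending on $\Omega$). "$R$ small enough" means that $\mathscr{C}_{M,R}$ is nonempty. The distance: for open $\Omega_1,\Omega_2\subset B^*$, $$\rho(\Omega_1,\Omega_2)=\max\Big\{\sup_{x\in\overline{B^*}\setminus\Omega_1}\mathrm{dist}(x,\overline{B^*}\setminus\Omega_2),\ \sup_{y\in\overline{B^*}\setminus\Omega_2}\mathrm{dist}(y,\overline{B^*}\setminus\Omega_1)\Big\},$$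 i.e. the Hausdorff distance between the complements in $\overline{B^*}$. *)

theory Defs
  imports "HOL-Analysis.Analysis"
begin

text \<open>
  For a nonempty bounded open set the frontier is nonempty, so \<open>infdist\<close> (which is 0 for the
  empty set) is the genuine distance to the boundary for every member of the class below.
\<close>

definition property_C :: "real \<Rightarrow> (real ^ 'k) set \<Rightarrow> bool" where
  "property_C M \<Omega> \<longleftrightarrow>
     (\<forall>x\<in>\<Omega>. \<forall>y\<in>\<Omega>. \<exists>K.
        connected K \<and> compact K \<and> x \<in> K \<and> y \<in> K \<and> K \<subseteq> \<Omega> \<and>
        (\<Union>z\<in>K. ball z (min (infdist x (frontier \<Omega>)) (infdist y (frontier \<Omega>)) / M)) \<subseteq> \<Omega>)"

definition class_C :: "(real ^ 'k) set \<Rightarrow> real \<Rightarrow> real \<Rightarrow> (real ^ 'k) set set" where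
  "class_C B M R =
     {\<Omega>. open \<Omega> \<and> property_C M \<Omega> \<and> (\<exists>x\<in>\<Omega>. ball x R \<subseteq> \<Omega>) \<and> \<Omega> \<subseteq> B}"

text \<open>
  The distance is only meant for open subsets of \<open>B\<close>.  When \<open>B\<close> is nonempty and bounded, the
  two complements in \<open>closure B\<close> are then nonempty and bounded (they contain the frontier of
  \<open>B\<close>), so both suprema are proper.  Off this domain the value is set to 0, because the locale
  \<open>Metric_space\<close> demands nonnegativity and symmetry for all arguments and not only on its
  carrier, and the real supremum of an empty or unbounded set is unspecified.
\<close>

definition rho :: "(real ^ 'k) set \<Rightarrow> (real ^ 'k) set \<Rightarrow> (real ^ 'k) set \<Rightarrow> real" where
  "rho B \<Omega>1 \<Omega>2 =
     (if open \<Omega>1 \<and> \<Omega>1 \<subseteq> B \<and> open \<Omega>2 \<and> \<Omega>2 \<subseteq> B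
      then max (SUP x\<in>closure B - \<Omega>1. infdist x (closure B - \<Omega>2))
               (SUP y\<in>closure B - \<Omega>2. infdist y (closure B - \<Omega>1))
      else 0)"

end

theory Submission
  imports Defs "HOL-Complex_Analysis.Great_Picard"
begin

text \<open>
  Identify \<open>\<Omega>\<close> with the compact set \<open>closure B - \<Omega>\<close>.  Blaschke selection (Arzela--Ascoli
  applied to the 1-Lipschitz functions \<open>infdist _ (closure B - \<Omega>\<^sub>m)\<close>) gives a convergent
  subsequence, so it remains to see that the class is closed.  Since \<open>ball z r \<subseteq> \<Omega>\<close> means
  \<open>r \<le> infdist z (closure B - \<Omega>)\<close> for \<open>z \<in> \<Omega>\<close>, both defining conditions are closed conditions on
  these distance functions, except for the existence of a joining continuum.
\<close>

section \<open>Selecting a Hausdorff-convergent subsequence of closed sets\<close>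

lemma infdist_le_infdist_add:
  fixes F :: "'a::heine_borel set"
  assumes "closed F" "F \<noteq> {}" and le: "\<And>y. y \<in> F \<Longrightarrow> infdist y G \<le> e"
  shows "infdist x G \<le> infdist x F + e"
proof -
  obtain p where p: "p \<in> F" "infdist x F = dist x p"
    using infdist_attains_inf assms by metis
  show ?thesis
    using infdist_triangle[of x G p] le[OF p(1)] p(2) by simp
qed

text \<open>The uniform limit \<open>g\<close> of the distance functions turns out to be the
  distance to its own zero set \<open>L\<close>. For one inequality, nearest points to
  \<open>x\<close> in the sets \<open>F (r j)\<close> subconverge to a point of \<open>L\<close> at
  distance \<open>g x\<close>. For the other, the 1-Lipschitz bound between \<open>x\<close> and a
  point of \<open>L\<close> passes to the limit.\<close>

lemma Blaschke_selection:
  fixes F :: "nat \<Rightarrow> 'a::euclidean_space set"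
  assumes "compact A"
    and F: "\<And>n. closed (F n)" "\<And>n. F n \<noteq> {}" "\<And>n. F n \<subseteq> A"
  obtains r :: "nat \<Rightarrow> nat" and L where "strict_mono r" "closed L" "L \<noteq> {}" "L \<subseteq> A"
    "uniform_limit A (\<lambda>j x. infdist x (F (r j))) (\<lambda>x. infdist x L) sequentially"
proof -
  have "norm (infdist x (F n)) \<le> diameter A" if "x \<in> A" for n x
  proof -
    obtain a where "a \<in> F n" using F(2) by blast
    then have "infdist x (F n) \<le> diameter A"
      using diameter_bounded_bound[of A x a] F(3) that compact_imp_bounded[OF \<open>compact A\<close>]
      by (meson infdist_le2 subsetD)
    then show ?thesis by (simp add: infdist_nonneg)
  qed
  \<comment> \<open>Equicontinuity: every distance function is 1-Lipschitz, so \<open>d = e\<close>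
    serves for all \<open>n\<close> at once.\<close>
  moreover have "\<exists>d. 0 < d \<and> (\<forall>n y. y \<in> A \<and> norm (x - y) < d \<longrightarrow>
      norm (infdist x (F n) - infdist y (F n)) < e)" if "0 < e" for x e
    using that by (metis dist_norm infdist_triangle_abs le_less_trans real_norm_def)
  ultimately obtain g r where g: "continuous_on A g" and r: "strict_mono (r :: nat \<Rightarrow> nat)"
    and lim: "\<And>e. 0 < e \<Longrightarrow> \<exists>N. \<forall>n x. n \<ge> N \<and> x \<in> A \<longrightarrow> norm (infdist x (F (r n)) - g x) < e"
    using Arzela_Ascoli[OF \<open>compact A\<close>, of "\<lambda>n x. infdist x (F n)"] by metis
  have ul: "uniform_limit A (\<lambda>j x. infdist x (F (r j))) g sequentially"
    unfolding uniform_limit_sequentially_iff dist_norm using lim by blast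
  define L where "L = {x \<in> A. g x = 0}"
  have "closed L"
    unfolding L_def using g \<open>compact A\<close>
    by (intro continuous_closed_preimage_constant) (auto simp: compact_imp_closed)
  have pt: "(\<lambda>j. infdist x (F (r j))) \<longlonglongrightarrow> g x" if "x \<in> A" for x
    using tendsto_uniform_limitI[OF ul that] .
  have near: "\<exists>p\<in>L. dist x p = g x" if "x \<in> A" for x
  proof -
    have "\<exists>p. p \<in> F (r j) \<and> infdist x (F (r j)) = dist x p" for j
      using infdist_attains_inf F by metis
    then obtain p where p: "\<And>j. p j \<in> F (r j)" "\<And>j. infdist x (F (r j)) = dist x (p j)"
      by metis
    obtain l s where ls: "l \<in> A" "strict_mono (s :: nat \<Rightarrow> nat)" "(p \<circ> s) \<longlonglongrightarrow> l"
      using \<open>compact A\<close> F(3) p(1) unfolding compact_def by (meson subsetD)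
    have "(\<lambda>j. dist x ((p \<circ> s) j)) \<longlonglongrightarrow> dist x l"
      by (intro tendsto_intros ls)
    moreover have "(\<lambda>j. dist x ((p \<circ> s) j)) \<longlonglongrightarrow> g x"
      using LIMSEQ_subseq_LIMSEQ[OF pt[OF that] ls(2)] by (simp add: p o_def)
    ultimately have "dist x l = g x" by (rule LIMSEQ_unique)
    moreover have "g l = 0"
    proof -
      have "(\<lambda>j. infdist l (F (r (s j)))) \<longlonglongrightarrow> 0"
      proof (rule real_tendsto_sandwich[OF _ _ tendsto_const])
        show "\<forall>\<^sub>F j in sequentially. infdist l (F (r (s j))) \<le> dist l ((p \<circ> s) j)"
          by (simp add: infdist_le p)
        show "(\<lambda>j. dist l ((p \<circ> s) j)) \<longlonglongrightarrow> 0"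
          using tendsto_dist[OF tendsto_const[of l] ls(3)] by simp
      qed (simp add: infdist_nonneg)
      moreover have "(\<lambda>j. infdist l (F (r (s j)))) \<longlonglongrightarrow> g l"
        using LIMSEQ_subseq_LIMSEQ[OF pt[OF \<open>l \<in> A\<close>] ls(2)] by (simp add: o_def)
      ultimately show ?thesis by (metis LIMSEQ_unique)
    qed
    ultimately show ?thesis using \<open>l \<in> A\<close> by (auto simp: L_def)
  qed
  have "L \<noteq> {}" using near F(2,3) by blast
  have eq: "infdist x L = g x" if "x \<in> A" for x
  proof (rule antisym)
    show "infdist x L \<le> g x" using near[OF that] by (metis infdist_le)
    have "g x \<le> dist x q" if "q \<in> L" for q
    proof (rule LIMSEQ_le)
      show "(\<lambda>j. infdist x (F (r j))) \<longlonglongrightarrow> g x" by (rule pt[OF \<open>x \<in> A\<close>])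
      show "(\<lambda>j. infdist q (F (r j)) + dist x q) \<longlonglongrightarrow> dist x q"
        using tendsto_add[OF pt[of q] tendsto_const[of "dist x q"]] that by (simp add: L_def)
    qed (simp add: infdist_triangle)
    then show "g x \<le> infdist x L"
      unfolding infdist_notempty[OF \<open>L \<noteq> {}\<close>] by (intro cINF_greatest[OF \<open>L \<noteq> {}\<close>])
  qed
  have "uniform_limit A (\<lambda>j x. infdist x (F (r j))) (\<lambda>x. infdist x L) sequentially"
    using uniform_limit_cong'[of A _ _ g "\<lambda>x. infdist x L"] ul eq by (metis (no_types, lifting))
  then show thesis
    using that r \<open>closed L\<close> \<open>L \<noteq> {}\<close> by (auto simp: L_def)
qed

section \<open>The metric \<open>rho\<close> on open subsets of \<open>B\<close>\<close>

context
  fixes B :: "(real ^ 'k) set"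
  assumes B: "open B" "B \<noteq> {}" "bounded B"
begin

lemma compact_complement: "open \<Omega> \<Longrightarrow> compact (closure B - \<Omega>)"
  using B by (simp add: compact_diff)

text \<open>The frontier of the open set \<open>B\<close> is disjoint from \<open>B\<close>, and it
  is nonempty since \<open>B\<close> is nonempty and bounded. This keeps \<open>infdist\<close> to a
  complement away from its default value for the empty set.\<close>

lemma complement_nonempty:
  assumes "\<Omega> \<subseteq> B"
  shows "closure B - \<Omega> \<noteq> {}"
proof -
  have "frontier B \<noteq> {}"
    using B not_bounded_UNIV by (metis frontier_not_empty)
  then show ?thesis
    using assms B by (auto simp: frontier_def interior_open)
qed

lemma complement_inject:
  assumes "\<Omega>1 \<subseteq> B" "\<Omega>2 \<subseteq> B" "closure B - \<Omega>1 = closure B - \<Omega>2"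
  shows "\<Omega>1 = \<Omega>2"
  using assms closure_subset[of B] by blast

text \<open>Replaces the two suprema by pointwise bounds. It needs nonempty index sets, and bounded
  images, which come from compactness of the complements.\<close>

lemma rho_le_iff:
  assumes "open \<Omega>1" "\<Omega>1 \<subseteq> B" "open \<Omega>2" "\<Omega>2 \<subseteq> B"
  shows "rho B \<Omega>1 \<Omega>2 \<le> e \<longleftrightarrow>
    (\<forall>x\<in>closure B - \<Omega>1. infdist x (closure B - \<Omega>2) \<le> e) \<and>
    (\<forall>x\<in>closure B - \<Omega>2. infdist x (closure B - \<Omega>1) \<le> e)"
proof -
  have "(SUP x\<in>closure B - \<Omega>. infdist x G) \<le> e \<longleftrightarrow> (\<forall>x\<in>closure B - \<Omega>. infdist x G \<le> e)"
    if "open \<Omega>" "\<Omega> \<subseteq> B" for G \<Omega>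
    by (intro cSUP_le_iff complement_nonempty bounded_imp_bdd_above compact_imp_bounded
          compact_continuous_image continuous_intros compact_complement that)
  then show ?thesis
    using assms by (simp add: rho_def)
qed

text \<open>The definition of \<open>rho\<close> controls distances only at points of the
  complements; passing through a nearest point extends the control to the whole space. With the
  symmetry of \<open>rho\<close>, the two distance functions differ by at most \<open>rho\<close>
  everywhere, which is the form used below.\<close>

lemma infdist_complement_le_rho:
  assumes "open \<Omega>1" "\<Omega>1 \<subseteq> B" "open \<Omega>2" "\<Omega>2 \<subseteq> B"
  shows "infdist x (closure B - \<Omega>2) \<le> infdist x (closure B - \<Omega>1) + rho B \<Omega>1 \<Omega>2"
  using rho_le_iff[OF assms, of "rho B \<Omega>1 \<Omega>2"] assms
  by (intro infdist_le_infdist_add complement_nonempty compact_imp_closed compact_complement) auto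

lemma rho_commute: "rho B \<Omega>1 \<Omega>2 = rho B \<Omega>2 \<Omega>1"
  by (simp add: rho_def max.commute conj_ac)

lemma rho_nonneg: "0 \<le> rho B \<Omega>1 \<Omega>2"
proof (cases "open \<Omega>1 \<and> \<Omega>1 \<subseteq> B \<and> open \<Omega>2 \<and> \<Omega>2 \<subseteq> B")
  case True
  then obtain x where "x \<in> closure B - \<Omega>1" using complement_nonempty by blast
  then have "infdist x (closure B - \<Omega>2) \<le> rho B \<Omega>1 \<Omega>2"
    using rho_le_iff[of \<Omega>1 \<Omega>2 "rho B \<Omega>1 \<Omega>2"] True by blast
  then show ?thesis using infdist_nonneg order_trans by blast
qed (auto simp: rho_def)

lemma rho_triangle:
  assumes "open \<Omega>1" "\<Omega>1 \<subseteq> B" "open \<Omega>2" "\<Omega>2 \<subseteq> B" "open \<Omega>3" "\<Omega>3 \<subseteq> B"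
  shows "rho B \<Omega>1 \<Omega>3 \<le> rho B \<Omega>1 \<Omega>2 + rho B \<Omega>2 \<Omega>3"
proof -
  have "infdist x (closure B - \<Omega>3) \<le> rho B \<Omega>1 \<Omega>2 + rho B \<Omega>2 \<Omega>3"
    if "x \<in> closure B - \<Omega>1" for x
    using infdist_complement_le_rho[of \<Omega>1 \<Omega>2 x] infdist_complement_le_rho[of \<Omega>2 \<Omega>3 x] assms that
    by simp
  moreover have "infdist x (closure B - \<Omega>1) \<le> rho B \<Omega>1 \<Omega>2 + rho B \<Omega>2 \<Omega>3"
    if "x \<in> closure B - \<Omega>3" for x
    using infdist_complement_le_rho[of \<Omega>2 \<Omega>1 x] infdist_complement_le_rho[of \<Omega>3 \<Omega>2 x] assms that
    by (simp add: rho_commute)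
  ultimately show ?thesis using assms by (simp add: rho_le_iff)
qed

lemma rho_eq_0_iff:
  assumes "open \<Omega>1" "\<Omega>1 \<subseteq> B" "open \<Omega>2" "\<Omega>2 \<subseteq> B"
  shows "rho B \<Omega>1 \<Omega>2 = 0 \<longleftrightarrow> \<Omega>1 = \<Omega>2"
proof
  assume "rho B \<Omega>1 \<Omega>2 = 0"
  then have *: "infdist x (closure B - \<Omega>1) = infdist x (closure B - \<Omega>2)" for x
    using infdist_complement_le_rho[of \<Omega>1 \<Omega>2 x] infdist_complement_le_rho[of \<Omega>2 \<Omega>1 x] assms
    by (simp add: rho_commute)
  \<comment> \<open>Each complement is closed and nonempty, so its distance function determines
    it.\<close>
  have zero: "closure B - \<Omega> = {x. infdist x (closure B - \<Omega>) = 0}" if "open \<Omega>" "\<Omega> \<subseteq> B" for \<Omega>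
    using in_closed_iff_infdist_zero[OF compact_imp_closed[OF compact_complement] complement_nonempty] that
    by blast
  have "closure B - \<Omega>1 = {x. infdist x (closure B - \<Omega>1) = 0}"
    by (rule zero[OF assms(1,2)])
  also have "\<dots> = {x. infdist x (closure B - \<Omega>2) = 0}"
    by (simp only: *)
  also have "\<dots> = closure B - \<Omega>2"
    by (rule zero[OF assms(3,4), symmetric])
  finally have "closure B - \<Omega>1 = closure B - \<Omega>2" .
  then show "\<Omega>1 = \<Omega>2" using complement_inject assms by blast
next
  assume "\<Omega>1 = \<Omega>2"
  then have "rho B \<Omega>1 \<Omega>2 \<le> 0" using assms by (simp add: rho_le_iff)
  then show "rho B \<Omega>1 \<Omega>2 = 0" using rho_nonneg[of \<Omega>1 \<Omega>2] by linarith
qed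

section \<open>The defining conditions in terms of distance to the complement\<close>

lemma frontier_subset_complement:
  assumes "open \<Omega>" "\<Omega> \<subseteq> B"
  shows "frontier \<Omega> \<subseteq> closure B - \<Omega>"
  using assms closure_mono[of \<Omega> B] by (auto simp: frontier_def interior_open)

text \<open>The segment from \<open>x\<close> to a nearest point of the complement must cross the
  frontier, and the crossing point is no farther away.\<close>

lemma infdist_frontier_eq:
  assumes "open \<Omega>" "\<Omega> \<subseteq> B" "x \<in> \<Omega>"
  shows "infdist x (frontier \<Omega>) = infdist x (closure B - \<Omega>)"
proof (rule antisym)
  obtain p where p: "p \<in> closure B - \<Omega>" "infdist x (closure B - \<Omega>) = dist x p"
    using infdist_attains_inf complement_nonempty compact_complement compact_imp_closed assms by metis
  obtain q where q: "q \<in> closed_segment x p" "q \<in> frontier \<Omega>"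
    using connected_Int_frontier[of "closed_segment x p" \<Omega>] p(1) assms(3) by auto
  have "dist x q \<le> dist x p"
    using dist_in_closed_segment[OF q(1)] by (simp add: dist_commute)
  then show "infdist x (frontier \<Omega>) \<le> infdist x (closure B - \<Omega>)"
    using q(2) p(2) infdist_le2 by metis
  show "infdist x (closure B - \<Omega>) \<le> infdist x (frontier \<Omega>)"
    using frontier_subset_complement q(2) assms by (intro infdist_mono) auto
qed

text \<open>The complement is taken only inside \<open>closure B\<close>, yet this suffices: a
  connected ball centred in \<Omega> can leave \<Omega> only across the frontier of \<Omega>, which
  lies in \<open>closure B\<close>.\<close>

lemma ball_subset_iff_le_infdist:
  assumes "open \<Omega>" "\<Omega> \<subseteq> B" "z \<in> \<Omega>"
  shows "ball z r \<subseteq> \<Omega> \<longleftrightarrow> r \<le> infdist z (closure B - \<Omega>)"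
proof
  assume sub: "ball z r \<subseteq> \<Omega>"
  obtain p where "p \<in> closure B - \<Omega>" "infdist z (closure B - \<Omega>) = dist z p"
    using infdist_attains_inf complement_nonempty compact_complement compact_imp_closed assms by metis
  with sub show "r \<le> infdist z (closure B - \<Omega>)"
    by (metis DiffD2 mem_ball not_le subsetD)
next
  assume le: "r \<le> infdist z (closure B - \<Omega>)"
  have "p \<notin> ball z r" if "p \<in> frontier \<Omega>" for p
    using infdist_le[of p "closure B - \<Omega>" z] le that frontier_subset_complement[OF assms(1,2)] by auto
  then have "ball z r \<inter> frontier \<Omega> = {}" by blast
  \<comment> \<open>If the radius is not positive the ball is empty; otherwise its centre witnesses
    that it meets \<Omega>.\<close>
  then show "ball z r \<subseteq> \<Omega>"
    using connected_Int_frontier[OF connected_ball, of z r \<Omega>] assms(3)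
    by (metis Diff_eq_empty_iff ball_empty centre_in_ball disjoint_iff empty_subsetI not_le)
qed

lemma property_C_iff:
  assumes "open \<Omega>" "\<Omega> \<subseteq> B"
  shows "property_C M \<Omega> \<longleftrightarrow>
     (\<forall>x\<in>\<Omega>. \<forall>y\<in>\<Omega>. \<exists>K. connected K \<and> compact K \<and> x \<in> K \<and> y \<in> K \<and> K \<subseteq> \<Omega> \<and>
        (\<forall>z\<in>K. min (infdist x (closure B - \<Omega>)) (infdist y (closure B - \<Omega>)) / M
             \<le> infdist z (closure B - \<Omega>)))"
proof -
  have "(\<Union>z\<in>K. ball z r) \<subseteq> \<Omega> \<longleftrightarrow> (\<forall>z\<in>K. r \<le> infdist z (closure B - \<Omega>))" if "K \<subseteq> \<Omega>" for K r
    unfolding UN_subset_iff using that by (intro ball_cong refl ball_subset_iff_le_infdist[OF assms]) blast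
  then show ?thesis
    unfolding property_C_def using infdist_frontier_eq[OF assms] by (simp cong: conj_cong)
qed

section \<open>Stability of the defining conditions under limits\<close>

lemma infdist_complement_tendsto:
  assumes "\<And>m. open (\<Omega>s m)" "\<And>m. \<Omega>s m \<subseteq> B" "open \<Omega>" "\<Omega> \<subseteq> B"
    and "(\<lambda>m. rho B (\<Omega>s m) \<Omega>) \<longlonglongrightarrow> 0"
  shows "(\<lambda>m. infdist x (closure B - \<Omega>s m)) \<longlonglongrightarrow> infdist x (closure B - \<Omega>)"
proof (rule metric_tendsto_imp_tendsto[OF assms(5)])
  have "\<bar>infdist x (closure B - \<Omega>s m) - infdist x (closure B - \<Omega>)\<bar> \<le> rho B (\<Omega>s m) \<Omega>" for m
    using infdist_complement_le_rho[of "\<Omega>s m" \<Omega> x] infdist_complement_le_rho[of \<Omega> "\<Omega>s m" x] assms(1-4)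
    by (simp add: rho_commute abs_le_iff)
  then show "\<forall>\<^sub>F m in sequentially. dist (infdist x (closure B - \<Omega>s m)) (infdist x (closure B - \<Omega>))
      \<le> dist (rho B (\<Omega>s m) \<Omega>) 0"
    by (simp add: dist_real_def rho_nonneg)
qed

lemma mem_iff_infdist_complement_pos:
  assumes "open \<Omega>" "\<Omega> \<subseteq> B" "x \<in> closure B"
  shows "x \<in> \<Omega> \<longleftrightarrow> 0 < infdist x (closure B - \<Omega>)"
  using infdist_pos_not_in_closed[OF compact_imp_closed[OF compact_complement] complement_nonempty] assms
  by (metis DiffD2 DiffI infdist_zero less_irrefl)

text \<open>
  Joining continua of the approximating sets lie in almost-admissible compact sets \<open>T e\<close> for the
  limit set.  The components of \<open>x\<close> in these sets are nested continua, and their intersection is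
  the required joining continuum.
\<close>

lemma property_C_limit:
  assumes \<Omega>s: "\<And>m. open (\<Omega>s m)" "\<And>m. \<Omega>s m \<subseteq> B" "\<And>m. property_C M (\<Omega>s m)"
    and \<Omega>: "open \<Omega>" "\<Omega> \<subseteq> B"
    and lim: "(\<lambda>m. rho B (\<Omega>s m) \<Omega>) \<longlonglongrightarrow> 0"
    and M: "1 \<le> M"
  shows "property_C M \<Omega>"
  unfolding property_C_iff[OF \<Omega>]
proof (intro ballI)
  fix x y assume xy: "x \<in> \<Omega>" "y \<in> \<Omega>"
  let ?d = "\<lambda>z. infdist z (closure B - \<Omega>)"
  define c where "c = min (?d x) (?d y)"
  have xyB: "x \<in> closure B" "y \<in> closure B"
    using xy \<Omega> closure_subset by blast+
  then have "c > 0"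
    using xy \<Omega> by (simp add: c_def mem_iff_infdist_complement_pos)
  define T where "T e = {z \<in> closure B. c / M - e \<le> ?d z}" for e
  have "T e = closure B \<inter> {z. c / M - e \<le> ?d z}" for e
    by (auto simp: T_def)
  moreover have "closed {z. c / M - e \<le> ?d z}" for e
    by (intro closed_Collect_le continuous_intros)
  ultimately have T_compact: "compact (T e)" for e
    using B by (simp add: compact_Int_closed)
  have join: "connected_component (T e) x y" if "e > 0" for e
  proof -
    \<comment> \<open>The bound by \<open>c\<close> puts \<open>x\<close> and \<open>y\<close> into
      \<open>\<Omega>s m\<close>. The bound by \<open>e / 2\<close> pays for two errors, one in
      passing to the distances for \<open>\<Omega>s m\<close> and one in returning to those for
      \<Omega>.\<close>
    have "\<forall>\<^sub>F m in sequentially. rho B (\<Omega>s m) \<Omega> < min c (e / 2)"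
      using order_tendstoD(2)[OF lim, of "min c (e / 2)"] \<open>c > 0\<close> \<open>e > 0\<close> by simp
    then obtain m where m: "rho B (\<Omega>s m) \<Omega> < c" "rho B (\<Omega>s m) \<Omega> < e / 2"
      using eventually_happens by fastforce
    let ?r = "rho B (\<Omega>s m) \<Omega>"
    let ?D = "\<lambda>z. infdist z (closure B - \<Omega>s m)"
    have D: "?d z \<le> ?D z + ?r" "?D z \<le> ?d z + ?r" for z
      using infdist_complement_le_rho[of "\<Omega>s m" \<Omega> z] infdist_complement_le_rho[of \<Omega> "\<Omega>s m" z] \<Omega>s \<Omega>
      by (simp_all add: rho_commute)
    have "0 < ?D x" "0 < ?D y"
      using D(1)[of x] D(1)[of y] m(1) by (auto simp: c_def)
    then have "x \<in> \<Omega>s m" "y \<in> \<Omega>s m"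
      using mem_iff_infdist_complement_pos[OF \<Omega>s(1,2)] xyB by simp_all
    then obtain K where K: "connected K" "x \<in> K" "y \<in> K" "K \<subseteq> \<Omega>s m"
      "\<And>z. z \<in> K \<Longrightarrow> min (?D x) (?D y) / M \<le> ?D z"
      using \<Omega>s(3)[of m] property_C_iff[of "\<Omega>s m" M] \<Omega>s(1,2) by metis
    have "K \<subseteq> T e"
    proof
      \<comment> \<open>The first error gets divided by \<open>M\<close>; since
        \<open>1 \<le> M\<close>, it still costs at most
        \<open>rho B (\<Omega>s m) \<Omega>\<close>.\<close>
      fix z assume z: "z \<in> K"
      have "?r / M \<le> ?r"
        using M rho_nonneg[of "\<Omega>s m" \<Omega>] by (simp add: divide_le_eq mult_le_cancel_left1)
      then have "c / M - ?r \<le> (c - ?r) / M"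
        by (simp add: diff_divide_distrib)
      also have "\<dots> \<le> min (?D x) (?D y) / M"
        using D(1)[of x] D(1)[of y] M by (intro divide_right_mono) (auto simp: c_def)
      also have "\<dots> \<le> ?d z + ?r"
        using K(5)[OF z] D(2)[of z] by simp
      finally have "c / M - e \<le> ?d z" using m(2) by simp
      then show "z \<in> T e"
        using z K(4) \<Omega>s(2)[of m] closure_subset[of B] by (auto simp: T_def)
    qed
    with K show ?thesis by (auto simp: connected_component_def)
  qed
  \<comment> \<open>The continua found for different \<open>e\<close> need not be nested, but the
    components of \<open>x\<close> in the decreasing sets \<open>T\<close> are, and each contains
    \<open>y\<close> by \<open>join\<close>.\<close>
  define S where "S n = connected_component_set (T (1 / real (Suc n))) x" for n
  define K where "K = \<Inter>(range S)"
  have S: "compact (S n)" "connected (S n)" "x \<in> S n" "y \<in> S n" for n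
  proof -
    have xy': "connected_component (T (1 / real (Suc n))) x y" by (simp add: join)
    then have "x \<in> T (1 / real (Suc n))" using connected_component_in by blast
    then show "compact (S n)" "x \<in> S n"
      unfolding S_def using compact_components[OF T_compact componentsI] by auto
    show "connected (S n)" "y \<in> S n"
      using xy' by (simp_all add: S_def)
  qed
  have "S n \<subseteq> S m" if "m \<le> n" for m n
  proof -
    have "1 / real (Suc n) \<le> 1 / real (Suc m)"
      using that by (intro divide_left_mono) auto
    then show ?thesis
      unfolding S_def by (intro connected_component_mono) (auto simp: T_def)
  qed
  \<comment> \<open>A decreasing intersection of connected sets may be disconnected in general;
    compactness of the sets \<open>S n\<close> prevents this.\<close>
  then have "connected K"
    unfolding K_def by (intro connected_nest S)
  moreover have "compact K"
    unfolding K_def by (intro compact_Inter) (auto simp: S)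
  moreover have "x \<in> K" "y \<in> K"
    by (auto simp: K_def S)
  moreover have K_le: "c / M \<le> ?d z" and K_B: "z \<in> closure B" if "z \<in> K" for z
  proof -
    have z: "z \<in> T (1 / real (Suc n))" for n
      using that connected_component_subset[of "T (1 / real (Suc n))" x] by (auto simp: K_def S_def)
    then show "z \<in> closure B" by (auto simp: T_def)
    show "c / M \<le> ?d z"
    proof (rule LIMSEQ_le)
      show "(\<lambda>n. c / M - 1 / real (Suc n)) \<longlonglongrightarrow> c / M"
        using tendsto_diff[OF tendsto_const[of "c / M"] LIMSEQ_inverse_real_of_nat]
        by (simp add: divide_inverse)
      show "(\<lambda>n. ?d z) \<longlonglongrightarrow> ?d z" by simp
    qed (use z in \<open>auto simp: T_def\<close>)
  qed
  \<comment> \<open>The lower bound \<open>c / M\<close> survives the limit and is positive, so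
    \<open>K\<close> stays off the boundary of \<Omega>.\<close>
  moreover have "K \<subseteq> \<Omega>"
  proof
    fix z assume "z \<in> K"
    moreover have "0 < c / M" using M \<open>c > 0\<close> by simp
    ultimately show "z \<in> \<Omega>"
      using K_le K_B mem_iff_infdist_complement_pos[OF \<Omega>] by force
  qed
  ultimately show "\<exists>K. connected K \<and> compact K \<and> x \<in> K \<and> y \<in> K \<and> K \<subseteq> \<Omega> \<and>
      (\<forall>z\<in>K. min (?d x) (?d y) / M \<le> ?d z)"
    unfolding c_def by blast
qed

text \<open>The centres subconverge in \<open>closure B\<close>. The triangle inequality moves the
  bound \<open>R\<close> from each centre to the limit point with an error tending to 0, and
  \<open>0 < R\<close> then forces that point into \<Omega>.\<close>

lemma inball_limit:
  assumes \<Omega>s: "\<And>m. open (\<Omega>s m)" "\<And>m. \<Omega>s m \<subseteq> B" "\<And>m. \<exists>x\<in>\<Omega>s m. ball x R \<subseteq> \<Omega>s m"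
    and \<Omega>: "open \<Omega>" "\<Omega> \<subseteq> B"
    and lim: "(\<lambda>m. rho B (\<Omega>s m) \<Omega>) \<longlonglongrightarrow> 0"
    and "0 < R"
  shows "\<exists>x\<in>\<Omega>. ball x R \<subseteq> \<Omega>"
proof -
  obtain c where c: "\<And>m. c m \<in> \<Omega>s m" "\<And>m. ball (c m) R \<subseteq> \<Omega>s m"
    using \<Omega>s(3) by metis
  have "\<And>m. c m \<in> closure B"
    using c(1) \<Omega>s(2) closure_subset by blast
  moreover have "compact (closure B)" using B by simp
  ultimately obtain x s where x: "x \<in> closure B" and s: "strict_mono (s :: nat \<Rightarrow> nat)" "(c \<circ> s) \<longlonglongrightarrow> x"
    unfolding compact_def by meson
  have "R \<le> infdist x (closure B - \<Omega>)"
  proof (rule LIMSEQ_le)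
    have "(\<lambda>j. infdist x (closure B - \<Omega>s (s j)) + dist ((c \<circ> s) j) x) \<longlonglongrightarrow> infdist x (closure B - \<Omega>) + dist x x"
      using LIMSEQ_subseq_LIMSEQ[OF infdist_complement_tendsto[OF \<Omega>s(1,2) \<Omega> lim] s(1), of x]
      by (intro tendsto_intros s(2)) (simp add: o_def)
    then show "(\<lambda>j. infdist x (closure B - \<Omega>s (s j)) + dist (c (s j)) x) \<longlonglongrightarrow> infdist x (closure B - \<Omega>)"
      by simp
    have "R \<le> infdist (c m) (closure B - \<Omega>s m)" for m
      using ball_subset_iff_le_infdist[OF \<Omega>s(1,2) c(1)] c(2) by blast
    then show "\<exists>N. \<forall>n\<ge>N. R \<le> infdist x (closure B - \<Omega>s (s n)) + dist (c (s n)) x"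
      using order_trans[OF _ infdist_triangle] by blast
  qed simp
  moreover from this have "x \<in> \<Omega>"
    using mem_iff_infdist_complement_pos[OF \<Omega> x] \<open>0 < R\<close> by simp
  ultimately show ?thesis
    using ball_subset_iff_le_infdist[OF \<Omega>] by blast
qed

section \<open>Sequential compactness, first for all open subsets, then for the class\<close>

lemma open_subsets_sequentially_compact:
  assumes \<Omega>s: "\<And>m. open (\<Omega>s m)" "\<And>m. \<Omega>s m \<subseteq> B"
  obtains r :: "nat \<Rightarrow> nat" and \<Omega> where "strict_mono r" "open \<Omega>" "\<Omega> \<subseteq> B"
    "(\<lambda>j. rho B (\<Omega>s (r j)) \<Omega>) \<longlonglongrightarrow> 0"
proof -
  obtain r :: "nat \<Rightarrow> nat" and L where r: "strict_mono r" and L: "closed L" "L \<noteq> {}" "L \<subseteq> closure B"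
    and ul: "uniform_limit (closure B) (\<lambda>j x. infdist x (closure B - \<Omega>s (r j))) (\<lambda>x. infdist x L) sequentially"
  proof (rule Blaschke_selection)
    show "compact (closure B)" using B by simp
    show "closed (closure B - \<Omega>s m)" "closure B - \<Omega>s m \<noteq> {}" "closure B - \<Omega>s m \<subseteq> closure B" for m
      using compact_imp_closed[OF compact_complement[OF \<Omega>s(1)]] complement_nonempty[OF \<Omega>s(2)] by auto
  qed
  \<comment> \<open>Frontier points of \<open>B\<close> lie in every complement, so their distance
    to \<open>L\<close> is 0. Consequently the limit set \<open>closure B - L\<close> equals
    \<open>B - L\<close>, which is open and contained in \<open>B\<close>.\<close>
  have "frontier B \<subseteq> L"
  proof
    fix x assume x: "x \<in> frontier B"
    then have "x \<in> closure B - \<Omega>s m" for m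
      using \<Omega>s(2)[of m] B by (auto simp: frontier_def interior_open)
    moreover have "x \<in> closure B" using x by (simp add: frontier_def)
    ultimately have "(\<lambda>j. 0) \<longlonglongrightarrow> infdist x L"
      using tendsto_uniform_limitI[OF ul, of x] by simp
    then show "x \<in> L"
      using L in_closed_iff_infdist_zero LIMSEQ_const_iff by metis
  qed
  then have sub: "closure B - L \<subseteq> B"
    using B by (auto simp: frontier_def interior_open)
  then have "closure B - L = B - L" using closure_subset by blast
  then have op: "open (closure B - L)" using B L by (simp add: open_Diff)
  have compl: "closure B - (closure B - L) = L" using L by blast
  have "(\<lambda>j. rho B (\<Omega>s (r j)) (closure B - L)) \<longlonglongrightarrow> 0"
  proof (rule tendstoI)
    fix e :: real assume "0 < e"
    \<comment> \<open>Suprema preserve only weak inequalities, so \<open>e / 2\<close> is used to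
      reach a strict bound by \<open>e\<close>.\<close>
    have "rho B (\<Omega>s m) (closure B - L) \<le> e / 2"
      if "\<forall>x\<in>closure B. dist (infdist x (closure B - \<Omega>s m)) (infdist x L) < e / 2" for m
    proof -
      have "infdist x L \<le> e / 2" if "x \<in> closure B - \<Omega>s m" for x
        using \<open>\<forall>x\<in>closure B. _\<close> that by (force simp: dist_real_def)
      moreover have "infdist x (closure B - \<Omega>s m) \<le> e / 2" if "x \<in> L" for x
        using \<open>\<forall>x\<in>closure B. _\<close> that L by (force simp: dist_real_def)
      ultimately show ?thesis using rho_le_iff[OF \<Omega>s op sub, of m "e / 2"] unfolding compl by blast
    qed
    then show "\<forall>\<^sub>F j in sequentially. dist (rho B (\<Omega>s (r j)) (closure B - L)) 0 < e"
      using uniform_limitD[OF ul, of "e / 2"] \<open>0 < e\<close>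
      by (force simp: dist_real_def rho_nonneg elim!: eventually_mono)
  qed
  with r op sub show thesis by (rule that)
qed

lemma Metric_space_rho: "Metric_space (class_C B M R) (rho B)"
  by unfold_locales
    (auto simp: class_C_def rho_nonneg rho_commute rho_eq_0_iff intro: rho_triangle)

lemma class_C_sequentially_compact:
  assumes "\<And>m. \<Omega>s m \<in> class_C B M R" "1 \<le> M" "0 < R"
  obtains r :: "nat \<Rightarrow> nat" and \<Omega> where "strict_mono r" "\<Omega> \<in> class_C B M R"
    "(\<lambda>j. rho B (\<Omega>s (r j)) \<Omega>) \<longlonglongrightarrow> 0"
proof -
  have \<Omega>s: "open (\<Omega>s m)" "\<Omega>s m \<subseteq> B" "property_C M (\<Omega>s m)" "\<exists>x\<in>\<Omega>s m. ball x R \<subseteq> \<Omega>s m" for m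
    using assms(1)[of m] by (auto simp: class_C_def)
  obtain r :: "nat \<Rightarrow> nat" and \<Omega> where r: "strict_mono r" and \<Omega>: "open \<Omega>" "\<Omega> \<subseteq> B"
    and lim: "(\<lambda>j. rho B (\<Omega>s (r j)) \<Omega>) \<longlonglongrightarrow> 0"
    using open_subsets_sequentially_compact[of \<Omega>s] \<Omega>s(1,2) by blast
  have "property_C M \<Omega>"
    using property_C_limit[OF _ _ _ \<Omega> lim] \<Omega>s assms(2) by blast
  moreover have "\<exists>x\<in>\<Omega>. ball x R \<subseteq> \<Omega>"
    using inball_limit[OF _ _ _ \<Omega> lim] \<Omega>s assms(3) by blast
  ultimately have "\<Omega> \<in> class_C B M R"
    using \<Omega> by (simp add: class_C_def)
  with r lim show thesis by (intro that)
qed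

end

theorem theorem2p1:
  fixes B :: "(real ^ 'k) set" and M R :: real
  assumes "open B" and "connected B" and "B \<noteq> {}" and "bounded B"
    and "M > 1" and "R > 0"
    and "class_C B M R \<noteq> {}"
  shows "(\<forall>\<Omega>s :: nat \<Rightarrow> (real ^ 'k) set. (\<forall>m. \<Omega>s m \<in> class_C B M R) \<longrightarrow>
            (\<exists>r :: nat \<Rightarrow> nat. \<exists>\<Omega>. strict_mono r \<and> \<Omega> \<in> class_C B M R \<and>
               (\<lambda>j. rho B (\<Omega>s (r j)) \<Omega>) \<longlonglongrightarrow> 0))
         \<and> Metric_space (class_C B M R) (rho B)
         \<and> compact_space (Metric_space.mtopology (class_C B M R) (rho B))"
proof (intro conjI)
  show seq: "\<forall>\<Omega>s :: nat \<Rightarrow> (real ^ 'k) set. (\<forall>m. \<Omega>s m \<in> class_C B M R) \<longrightarrow>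
            (\<exists>r :: nat \<Rightarrow> nat. \<exists>\<Omega>. strict_mono r \<and> \<Omega> \<in> class_C B M R \<and>
               (\<lambda>j. rho B (\<Omega>s (r j)) \<Omega>) \<longlonglongrightarrow> 0)"
    using class_C_sequentially_compact[of B _ M R] assms by (metis less_imp_le)
  show ms: "Metric_space (class_C B M R) (rho B)"
    using Metric_space_rho assms by blast
  interpret Metric_space "class_C B M R" "rho B" by (rule ms)
  show "compact_space mtopology"
    \<comment> \<open>In a metric space compactness is sequential compactness, so the first conjunct
      supplies the subsequence.\<close>
    unfolding compact_space_sequentially
  proof (intro allI impI)
    fix \<sigma> :: "nat \<Rightarrow> (real ^ 'k) set"
    assume \<sigma>: "range \<sigma> \<subseteq> class_C B M R"
    then obtain r :: "nat \<Rightarrow> nat" and \<Omega> where "strict_mono r" "\<Omega> \<in> class_C B M R"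
      "(\<lambda>j. rho B (\<sigma> (r j)) \<Omega>) \<longlonglongrightarrow> 0"
      using seq by blast
    then show "\<exists>l r. l \<in> class_C B M R \<and> strict_mono r \<and> limitin mtopology (\<sigma> \<circ> r) l sequentially"
      using \<sigma> by (auto simp: limitin_metric_dist_null image_subset_iff)
  qed
qed

end
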